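(* Fix integers $m\ge2$ and $n\ge0$. Define $$d^{min}_n:=\begin{cases}\left\lfloor \frac{2n+2}{3}\right\rfloor & \text{if } n=3k \text{ or } n=3k+1 \text{ for some integer } k,\\[2pt] 2\left\lfloor\frac{n-1}{3}\right\rfloor+m & \text{if } n=3k+2 \text{ for some integer } k.\end{cases}$$ Let $C^d_n$ denote the number of $d$-dimensional cells, excluding the base $0$-cell, of the cell complex $X^m_n$ produced by the Comb Algorithm applied to $\mathrm{Ind}(\Delta^m_n)$. Then $C^d_n=0$ whenever $0\le d<d^{min}_n$. When $m=2$, the two formulas coincide, i.e. $2\left\lfloor\frac{n-1}{3}\right\rfloor+2=\left\lfloor\frac{2n+2}{3}\right\rfloor$ for $n=3k+2$.
   Context: All graphs are finite and simple; $N(p)$ is the set of neighbors of $p$. $\mathrm{Ind}(G)$ is the independence complex of $G$: the simplicial complex on $V(G)$ whose faces are the independent sets of $G$ (including $\emptyset$); a face with $r$ vertices has dimension $r-1$. $Pa_\ell$ is the path on $\ell$ vertices; $\biguplus$ is disjoint union. Graphs. For $m\ge1,n\ge 1$, $Y^m_n$ is the extended star: a central vertex of degree $m$ with $m$ paths ("tendrils") of $n$ edges each emanating from it; $Y^m_0$ is a single vertex. $\widehat Y^m_n$ consists of two vertices $a,b$ joined by $m$ internally disjoint paths with $n+1$ edges each; the $k$-th vertex away from $a$ on the $j$-th path is $(j,k)$. For $n\ge 1$, $\Delta^m_n$ is $\widehat Y^m_{n+1}$ with $n$ additional vertices $1,\dots,n$ and additional edges $\{k,(j,k)\}$, $\{k,(j,k+1)\}$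 for $j\in\{1,\dots,m\}$, $k\in\{1,\dots,n\}$. Also $\Delta^m_0:=\widehat Y^m_1$ and $\Delta^m_{-1}$ is a single vertex. Matching trees. For disjoint $A,B\subseteq V(G)$ let $\Sigma(A,B)=\{I\in\mathrm{Ind}(G): A\subseteq I,\ B\cap I=\emptyset\}$. A matching tree starts with the root $\Sigma(\emptyset,\emptyset)$; as long as some leaf $\Sigma(A,B)$ has at least two elements, perform one of: (1) if some $p\in V\setminus(A\cup B)$ has $N(p)\setminus(A\cup B)=\emptyset$, give the leaf one child labeled $\emptyset$ ($p$ is a free vertex); (2) if some $p\in V\setminus(A\cup B)$ has $N(p)\setminus(A\cup B)=\{v\}$, give the leaf one child $\Sigma(A\cup\{v\},B\cup N(v))$; (3) choose $v\in V\setminus(A\cup B)$ and give the leaf two children $\Sigma(A,B\cup\{v\})$ and $\Sigma(A\cup\{v\},B\cup N(v))$. The available graph at a node is the subgraph induced on $V\setminus(A\cup B)$. The critical cells are the faces $A$ for the nonempty final leaves $\Sigma(A,B)$. By discrete Morse theory, $\mathrm{Ind}(G)$ is homotopy equivalent to a cell complex with one $d$-cell for each $d$-dimensional critical cell, plus one extra $0$-cell (the base $0$-cell, present since $\emptyset$ is matched). Trees for auxiliary graphs. Path: repeatedly apply (2) with $p$ an end vertex and $v$ its neighbor, and (1) if an isolated vertex remains. $Y^m_n$ with $n\equiv 0 \bmod 3$: on each tendril in turn apply (2) starting from its leaf ($p$ the leaf, $v$ its neighbor, and so on) until the tendril is exhausted, then apply (1) to the central vertex. $Y^m_n$ with $n\not\equiv0\bmod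 3$: apply (3) with $v$ the central vertex, then the path trees to the remaining disjoint paths. $\widehat Y^m_n$: apply (3) with $v=b$; the available graphs are then $Y^m_{n-1}$ and $Y^m_n$ (centered at $a$), to which the previous trees are applied. Comb Algorithm for $\mathrm{Ind}(\Delta^m_n)$ ($m\ge2$, $n\ge1$): for $k=1,\dots,n$ successively apply (3) with $v=k$ at $\Sigma(\emptyset,\{1,\dots,k-1\})$. Then: at $\Sigma(\{1\},N(1))$ apply (1) with $p=a$; at $\Sigma(\{k\},N(k)\cup\{1,\dots,k-1\})$ for $2\le k\le n-1$, the available graph is $Y^m_{k-1}\biguplus\Delta^m_{n-(k+1)}$, and one applies the tree of $Y^m_{k-1}$ and then, below any nonempty leaf, recursively the Comb Algorithm for $\Delta^m_{n-(k+1)}$ (the tree of $\widehat Y^m_1$ if $n-(k+1)=0$); at $\Sigma(\{n\},N(n)\cup\{1,\dots,n-1\})$ apply (1) with $p=b$; at $\Sigma(\emptyset,\{1,\dots,n\})$ the available graph is $\widehat Y^m_{n+1}$ and one applies its tree. $X^m_n$ ($n\ge1$) is the resulting cell complex, homotopy equivalent to $\mathrm{Ind}(\Delta^m_n)$; $X^m_0:=S^0$ (two $0$-cells). $C^d_n$ is the number of $d$-cells of $X^m_n$ for $d\ge1$, and $C^0_n$ is one less than the number of $0$-cells (so for $n\ge 1$, $C^d_n$ is the number of critical cells of dimension $d$); $C^d_n=0$ if $d<0$ or $n<0$. *)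

theory Defs
  imports Complex_Main
begin

type_synonym 'v graph = "'v set \<times> 'v set set"

definition simple_graph :: "'v graph \<Rightarrow> bool" where
  "simple_graph G \<longleftrightarrow> finite (fst G) \<and> (\<forall>e\<in>snd G. e \<subseteq> fst G \<and> card e = 2)"

definition nbrs :: "'v graph \<Rightarrow> 'v \<Rightarrow> 'v set" where
  "nbrs G p = {q. {p, q} \<in> snd G}"

definition Ind :: "'v graph \<Rightarrow> 'v set set" where
  "Ind G = {I. I \<subseteq> fst G \<and> (\<forall>u\<in>I. \<forall>v\<in>I. {u, v} \<notin> snd G)}"

definition dim :: "'v set \<Rightarrow> int" where
  "dim F = int (card F) - 1"

datatype vertex = End_a | End_b | Inner nat nat | Extra nat

text \<open>The \<open>k\<close>-th vertex away from \<open>a\<close> on the \<open>j\<close>-th of the \<open>n + 1\<close>-edge paths from \<open>a\<close> to \<open>b\<close>.\<close>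

definition path_vertex :: "nat \<Rightarrow> nat \<Rightarrow> nat \<Rightarrow> vertex" where
  "path_vertex n j k = (if k = 0 then End_a else if k = n + 1 then End_b else Inner j k)"

definition Yhat :: "nat \<Rightarrow> nat \<Rightarrow> vertex graph" where
  "Yhat m n =
     ({End_a, End_b} \<union> {Inner j k | j k. j \<in> {1..m} \<and> k \<in> {1..n}},
      {{path_vertex n j k, path_vertex n j (k + 1)} | j k. j \<in> {1..m} \<and> k \<in> {0..n}})"

text \<open>For \<open>n = 0\<close> no vertices or edges are added, so \<open>Delta m 0 = Yhat m 1\<close>.\<close>

definition Delta :: "nat \<Rightarrow> nat \<Rightarrow> vertex graph" where
  "Delta m n =
     (fst (Yhat m (n + 1)) \<union> Extra ` {1..n},
      snd (Yhat m (n + 1))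
        \<union> {{Extra k, Inner j k} | j k. j \<in> {1..m} \<and> k \<in> {1..n}}
        \<union> {{Extra k, Inner j (k + 1)} | j k. j \<in> {1..m} \<and> k \<in> {1..n}})"

definition Sigma_node :: "'v graph \<Rightarrow> 'v set \<Rightarrow> 'v set \<Rightarrow> 'v set set" where
  "Sigma_node G A B = {I \<in> Ind G. A \<subseteq> I \<and> B \<inter> I = {}}"

text \<open>
  A matching tree is recorded by the step performed at each node; the labels \<open>\<Sigma>(A,B)\<close>
  are determined by the root label and these steps.  \<open>Free p\<close> is step (1), whose only child is
  the final leaf labelled \<open>\<emptyset>\<close>; \<open>Pivot p v t\<close> is step (2); \<open>Split v t t'\<close> is step (3), where
  \<open>t\<close> is the subtree at \<open>\<Sigma>(A, B \<union> {v})\<close> and \<open>t'\<close> the one at \<open>\<Sigma>(A \<union> {v}, B \<union> N(v))\<close>.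
  Thus \<open>Leaf\<close> never stands for a leaf labelled \<open>\<emptyset>\<close> that arises from step (1).
\<close>

datatype 'v mtree =
    Leaf
  | Free 'v
  | Pivot 'v 'v "'v mtree"
  | Split 'v "'v mtree" "'v mtree"

fun matching_tree :: "'v graph \<Rightarrow> 'v set \<Rightarrow> 'v set \<Rightarrow> 'v mtree \<Rightarrow> bool" where
  "matching_tree G A B Leaf \<longleftrightarrow> card (Sigma_node G A B) \<le> 1"
| "matching_tree G A B (Free p) \<longleftrightarrow>
     2 \<le> card (Sigma_node G A B) \<and>
     p \<in> fst G - (A \<union> B) \<and> nbrs G p - (A \<union> B) = {}"
| "matching_tree G A B (Pivot p v t) \<longleftrightarrow>
     2 \<le> card (Sigma_node G A B) \<and>
     p \<in> fst G - (A \<union> B) \<and> nbrs G p - (A \<union> B) = {v} \<and>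
     matching_tree G (A \<union> {v}) (B \<union> nbrs G v) t"
| "matching_tree G A B (Split v t t') \<longleftrightarrow>
     2 \<le> card (Sigma_node G A B) \<and>
     v \<in> fst G - (A \<union> B) \<and>
     matching_tree G A (B \<union> {v}) t \<and>
     matching_tree G (A \<union> {v}) (B \<union> nbrs G v) t'"

fun critical_cells :: "'v graph \<Rightarrow> 'v set \<Rightarrow> 'v set \<Rightarrow> 'v mtree \<Rightarrow> 'v set set" where
  "critical_cells G A B Leaf = (if Sigma_node G A B \<noteq> {} then {A} else {})"
| "critical_cells G A B (Free p) = {}"
| "critical_cells G A B (Pivot p v t) = critical_cells G (A \<union> {v}) (B \<union> nbrs G v) t"
| "critical_cells G A B (Split v t t') =
     critical_cells G A (B \<union> {v}) t \<union> critical_cells G (A \<union> {v}) (B \<union> nbrs G v) t'"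

text \<open>Continue a tree with the steps \<open>s\<close> below each of its leaves not labelled \<open>\<emptyset>\<close>.\<close>

fun graft :: "'v mtree \<Rightarrow> 'v mtree \<Rightarrow> 'v mtree" where
  "graft Leaf s = s"
| "graft (Free p) s = Free p"
| "graft (Pivot p v t) s = Pivot p v (graft t s)"
| "graft (Split v t t') s = Split v (graft t s) (graft t' s)"

text \<open>
  Where the construction leaves a choice open (the end of a path, the order of the tendrils), all
  choices are admitted, so the auxiliary trees and the Comb Algorithm are relations.
\<close>

text \<open>
  \<open>path_tree xs t\<close>: \<open>t\<close> is a tree for the path with consecutive vertices \<open>xs\<close>.  Choosing \<open>v = y\<close>
  next to the end \<open>p = x\<close> removes \<open>x\<close>, \<open>y\<close> and the other neighbour of \<open>y\<close>, if there is one.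
\<close>

inductive path_tree :: "'v list \<Rightarrow> 'v mtree \<Rightarrow> bool" where
  empty: "path_tree [] Leaf"
| isolated: "path_tree [x] (Free x)"
| step: "path_tree (drop 1 zs) t \<Longrightarrow> path_tree (x # y # zs) (Pivot x y t)"
| other_end: "path_tree (rev xs) t \<Longrightarrow> path_tree xs t"

inductive paths_tree :: "'v list list \<Rightarrow> 'v mtree \<Rightarrow> bool" where
  Nil: "paths_tree [] Leaf"
| Cons: "path_tree xs t \<Longrightarrow> paths_tree xss s \<Longrightarrow> paths_tree (xs # xss) (graft t s)"

text \<open>Step (2) applied along a list of consecutive vertices, always from its head.\<close>

fun peel :: "'v list \<Rightarrow> 'v mtree" where
  "peel (x # y # zs) = Pivot x y (peel (drop 1 zs))"
| "peel [x] = Free x"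
| "peel [] = Leaf"

abbreviation tendril_order :: "nat \<Rightarrow> nat list \<Rightarrow> bool" where
  "tendril_order m js \<equiv> distinct js \<and> set js = {1..m}"

text \<open>
  Trees for \<open>Y\<^sup>m\<^sub>n\<close>, realised with centre \<open>a\<close> and tendrils \<open>(j,1), \<dots>, (j,n)\<close>.  In the first
  rule \<open>n mod 3 = 0\<close>, so \<open>peel\<close> exhausts each tendril without meeting an isolated vertex.
\<close>

inductive star_tree :: "nat \<Rightarrow> nat \<Rightarrow> vertex mtree \<Rightarrow> bool" where
  mod_0: "n mod 3 = 0 \<Longrightarrow> tendril_order m js \<Longrightarrow>
    star_tree m n
      (foldr (\<lambda>j. graft (peel (map (Inner j) (rev [1..<n+1])))) js (Free End_a))"
| mod_not_0: "n mod 3 \<noteq> 0 \<Longrightarrow>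
    tendril_order m js \<Longrightarrow> paths_tree (map (\<lambda>j. map (Inner j) [1..<n+1]) js) t \<Longrightarrow>
    tendril_order m js' \<Longrightarrow> paths_tree (map (\<lambda>j. map (Inner j) [2..<n+1]) js') t' \<Longrightarrow>
    star_tree m n (Split End_a t t')"

inductive Yhat_tree :: "nat \<Rightarrow> nat \<Rightarrow> vertex mtree \<Rightarrow> bool" where
  "star_tree m n t \<Longrightarrow> star_tree m (n - 1) t' \<Longrightarrow> Yhat_tree m n (Split End_b t t')"

text \<open>
  After choosing \<open>v = k\<close> the second component of the available graph is a copy of \<open>Delta m (n - (k + 1))\<close>
  in which vertex \<open>k + 1\<close> plays the role of \<open>a\<close>; \<open>shift (k + 1)\<close> is the isomorphism onto it.
\<close>

fun shift :: "nat \<Rightarrow> vertex \<Rightarrow> vertex" where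
  "shift s End_a = Extra s"
| "shift s End_b = End_b"
| "shift s (Inner j i) = Inner j (s + i)"
| "shift s (Extra i) = Extra (s + i)"

text \<open>
  \<open>comb_tree m n t\<close>: \<open>t\<close> is a run of the Comb Algorithm on \<open>Delta m n\<close>.
  \<open>comb_branch m n k t\<close>: \<open>t\<close> is a continuation at \<open>\<Sigma>({k}, N(k) \<union> {1,\<dots>,k-1})\<close>.
  For \<open>n = 1\<close> the branch \<open>k = 1 = n\<close> may use either free vertex.
\<close>

inductive comb_tree :: "nat \<Rightarrow> nat \<Rightarrow> vertex mtree \<Rightarrow> bool"
  and comb_branch :: "nat \<Rightarrow> nat \<Rightarrow> nat \<Rightarrow> vertex mtree \<Rightarrow> bool"
  for m :: nat where
  Delta_0: "Yhat_tree m 1 t \<Longrightarrow> comb_tree m 0 t"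
| spine: "1 \<le> n \<Longrightarrow> Yhat_tree m (n + 1) t \<Longrightarrow> \<forall>k\<in>{1..n}. comb_branch m n k (br k) \<Longrightarrow>
    comb_tree m n (foldr (\<lambda>k s. Split (Extra k) s (br k)) [1..<n+1] t)"
| first: "comb_branch m n 1 (Free End_a)"
| last: "comb_branch m n n (Free End_b)"
| middle: "2 \<le> k \<Longrightarrow> k \<le> n - 1 \<Longrightarrow> star_tree m (k - 1) s \<Longrightarrow> comb_tree m (n - (k + 1)) t \<Longrightarrow>
    comb_branch m n k (graft s (map_mtree (shift (k + 1)) t))"

text \<open>
  Only the numbers of cells of \<open>X\<^sup>m\<^sub>n\<close> are recorded, not the attaching maps: for \<open>n \<ge> 1\<close> one
  \<open>d\<close>-cell per \<open>d\<close>-dimensional critical cell of the run \<open>t\<close>, plus the base \<open>0\<close>-cell;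
  \<open>X\<^sup>m\<^sub>0 = S\<^sup>0\<close> has two \<open>0\<close>-cells, whatever the tree.
\<close>

definition X_num_cells :: "nat \<Rightarrow> nat \<Rightarrow> vertex mtree \<Rightarrow> int \<Rightarrow> nat" where
  "X_num_cells m n t d =
     (if n = 0 then (if d = 0 then 2 else 0)
      else card {F \<in> critical_cells (Delta m n) {} {} t. dim F = d} + (if d = 0 then 1 else 0))"

definition num_C :: "nat \<Rightarrow> nat \<Rightarrow> vertex mtree \<Rightarrow> int \<Rightarrow> nat" where
  "num_C m n t d =
     (if d < 0 then 0 else if d = 0 then X_num_cells m n t 0 - 1 else X_num_cells m n t d)"

definition d_min :: "nat \<Rightarrow> nat \<Rightarrow> int" where
  "d_min m n =
     (if \<exists>k::int. int n = 3 * k \<or> int n = 3 * k + 1 then \<lfloor>(2 * real n + 2) / 3\<rfloor>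
      else 2 * \<lfloor>(real n - 1) / 3\<rfloor> + int m)"

section \<open>The runs of the algorithm are matching trees, and there are some\<close>

text \<open>
  Validity of a matching tree in terms of the available vertex set \<open>S\<close> and adjacency \<open>E\<close> only.
\<close>

fun avail_tree :: "('v \<Rightarrow> 'v \<Rightarrow> bool) \<Rightarrow> 'v set \<Rightarrow> 'v mtree \<Rightarrow> bool" where
  "avail_tree E S Leaf \<longleftrightarrow> S = {}"
| "avail_tree E S (Free p) \<longleftrightarrow> p \<in> S \<and> (\<forall>y\<in>S. \<not> E p y)"
| "avail_tree E S (Pivot p v t) \<longleftrightarrow> p \<in> S \<and> (\<forall>y\<in>S. E p y \<longleftrightarrow> y = v) \<and> v \<in> S \<and> avail_tree E {y\<in>S. y \<noteq> v \<and> \<not> E v y} t"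
| "avail_tree E S (Split v t t') \<longleftrightarrow> v \<in> S \<and> avail_tree E (S - {v}) t \<and> avail_tree E {y\<in>S. y \<noteq> v \<and> \<not> E v y} t'"

lemma nbrs_sym: "q \<in> nbrs G p \<longleftrightarrow> p \<in> nbrs G q"
  by (simp add: nbrs_def insert_commute)

lemma two_cells:
  assumes G: "simple_graph G" and A: "A \<in> Ind G" "A \<inter> B = {}" "\<forall>x\<in>A. nbrs G x \<subseteq> B"
    and p: "p \<in> fst G - (A \<union> B)"
  shows "2 \<le> card (Sigma_node G A B)" "insert p A \<in> Ind G"
proof -
  have e: "{p,x} \<notin> snd G" "{x,p} \<notin> snd G" if "x \<in> A" for x
  proof -
    have "p \<notin> nbrs G x" using A p that by blast
    then show "{p,x} \<notin> snd G" "{x,p} \<notin> snd G" by (auto simp: nbrs_def insert_commute)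
  qed
  have "{p} \<notin> snd G" using G unfolding simple_graph_def by (metis card_1_singleton_iff One_nat_def num.distinct(1) numeral_eq_one_iff)
  then show ins: "insert p A \<in> Ind G" using A e p by (auto simp: Ind_def)
  have "finite (Sigma_node G A B)"
    by (rule finite_subset[of _ "Pow (fst G)"]) (use G in \<open>auto simp: Sigma_node_def Ind_def simple_graph_def\<close>)
  moreover have "{A, insert p A} \<subseteq> Sigma_node G A B"
    using ins A p by (auto simp: Sigma_node_def)
  moreover have "card {A, insert p A} = 2" using p by (simp add: card_2_iff) blast
  ultimately show "2 \<le> card (Sigma_node G A B)" by (metis card_mono)
qed

lemma avail_matching_tree:
  assumes G: "simple_graph G"
  shows "A \<in> Ind G \<Longrightarrow> A \<inter> B = {} \<Longrightarrow> \<forall>x\<in>A. nbrs G x \<subseteq> B \<Longrightarrow>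
    avail_tree (\<lambda>x y. {x,y} \<in> snd G) (fst G - (A \<union> B)) t \<Longrightarrow> matching_tree G A B t"
proof (induction t arbitrary: A B)
  case Leaf
  then have "Sigma_node G A B \<subseteq> {A}" by (auto simp: Sigma_node_def Ind_def)
  then have "card (Sigma_node G A B) \<le> card {A}" by (intro card_mono) auto
  then show ?case by simp
next
  case (Free p)
  have V: "nbrs G p \<subseteq> fst G" using G by (auto simp: nbrs_def simple_graph_def)
  show ?case using two_cells(1)[OF G Free(1-3)] Free(4) V by (auto simp: nbrs_def)
next
  case (Pivot p v t)
  have V: "nbrs G p \<subseteq> fst G" "v \<notin> nbrs G v" using G by (auto simp: nbrs_def simple_graph_def)
  have v: "v \<in> fst G - (A \<union> B)" using Pivot by auto
  have "fst G - (A \<union> {v} \<union> (B \<union> nbrs G v)) = {y \<in> fst G - (A \<union> B). y \<noteq> v \<and> {v, y} \<notin> snd G}"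
    by (auto simp: nbrs_def)
  moreover have "A \<inter> nbrs G v = {}" using Pivot(4) v nbrs_sym[of _ G v] by blast
  ultimately have "matching_tree G (A \<union> {v}) (B \<union> nbrs G v) t"
    using two_cells(2)[OF G Pivot(2-4) v] v V Pivot by (intro Pivot.IH) (auto)
  then show ?case using two_cells(1)[OF G Pivot(2-4) v] Pivot(5) V by (auto simp: nbrs_def)
next
  case (Split v t t')
  have V: "v \<notin> nbrs G v" using G by (auto simp: nbrs_def simple_graph_def)
  have v: "v \<in> fst G - (A \<union> B)" using Split by auto
  have "fst G - (A \<union> {v} \<union> (B \<union> nbrs G v)) = {y \<in> fst G - (A \<union> B). y \<noteq> v \<and> {v, y} \<notin> snd G}"
    by (auto simp: nbrs_def)
  moreover have "A \<inter> nbrs G v = {}" using Split(5) v nbrs_sym[of _ G v] by blast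
  ultimately have 1: "matching_tree G (A \<union> {v}) (B \<union> nbrs G v) t'"
    using two_cells(2)[OF G Split(3-5) v] v V Split by (intro Split.IH(2)) auto
  have "fst G - (A \<union> (B \<union> {v})) = fst G - (A \<union> B) - {v}" by auto
  then have "matching_tree G A (B \<union> {v}) t"
    using Split v by (intro Split.IH(1)) auto
  then show ?case using 1 two_cells(1)[OF G Split(3-5) v] v by auto
qed

lemma avail_cong: "avail_tree E S t \<Longrightarrow> (\<And>x y. x \<in> S \<Longrightarrow> y \<in> S \<Longrightarrow> E x y = E' x y) \<Longrightarrow> avail_tree E' S t"
proof (induction t arbitrary: S)
  case (Pivot p v t)
  have "{y\<in>S. y \<noteq> v \<and> \<not> E v y} = {y\<in>S. y \<noteq> v \<and> \<not> E' v y}" using Pivot by auto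
  then have "avail_tree E' {y\<in>S. y \<noteq> v \<and> \<not> E' v y} t" using Pivot(2) by (intro Pivot.IH) (auto simp: Pivot.prems(2))
  then show ?case using Pivot by auto
next
  case (Split v t t')
  have "{y\<in>S. y \<noteq> v \<and> \<not> E v y} = {y\<in>S. y \<noteq> v \<and> \<not> E' v y}" using Split by auto
  then have "avail_tree E' {y\<in>S. y \<noteq> v \<and> \<not> E' v y} t'" using Split(3) by (intro Split.IH(2)) (auto simp: Split.prems(2))
  moreover have "avail_tree E' (S - {v}) t" using Split by auto
  ultimately show ?case using Split by auto
qed auto

lemma avail_graft: "avail_tree E S t \<Longrightarrow> avail_tree E S' s \<Longrightarrow> S \<inter> S' = {} \<Longrightarrow> (\<And>x y. x \<in> S \<Longrightarrow> y \<in> S' \<Longrightarrow> \<not> E x y) \<Longrightarrow> avail_tree E (S \<union> S') (graft t s)"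
proof (induction t arbitrary: S)
  case (Pivot p v t)
  have "{y\<in>S \<union> S'. y \<noteq> v \<and> \<not> E v y} = {y\<in>S. y \<noteq> v \<and> \<not> E v y} \<union> S'" using Pivot by auto
  moreover have "avail_tree E ({y\<in>S. y \<noteq> v \<and> \<not> E v y} \<union> S') (graft t s)" using Pivot by (intro Pivot.IH) auto
  ultimately show ?case using Pivot by auto
next
  case (Split v t t')
  have "{y\<in>S \<union> S'. y \<noteq> v \<and> \<not> E v y} = {y\<in>S. y \<noteq> v \<and> \<not> E v y} \<union> S'" using Split by auto
  moreover have "avail_tree E ({y\<in>S. y \<noteq> v \<and> \<not> E v y} \<union> S') (graft t' s)" using Split by (intro Split.IH) auto
  moreover have "S \<union> S' - {v} = (S - {v}) \<union> S'" using Split by auto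
  moreover have "avail_tree E ((S - {v}) \<union> S') (graft t s)" using Split by (intro Split.IH) auto
  ultimately show ?case using Split by auto
qed auto

lemma avail_map: "avail_tree E S t \<Longrightarrow> inj_on f S \<Longrightarrow> (\<And>x y. x \<in> S \<Longrightarrow> y \<in> S \<Longrightarrow> E' (f x) (f y) = E x y) \<Longrightarrow> avail_tree E' (f ` S) (map_mtree f t)"
proof (induction t arbitrary: S)
  case (Pivot p v t)
  have "{y\<in>f ` S. y \<noteq> f v \<and> \<not> E' (f v) y} = f ` {y\<in>S. y \<noteq> v \<and> \<not> E v y}"
    using Pivot by (auto simp: inj_on_def)
  moreover have "avail_tree E' (f ` {y\<in>S. y \<noteq> v \<and> \<not> E v y}) (map_mtree f t)"
    using Pivot by (intro Pivot.IH) (auto simp: inj_on_def)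
  ultimately show ?case using Pivot by (auto simp: inj_on_def)
next
  case (Split v t t')
  have "{y\<in>f ` S. y \<noteq> f v \<and> \<not> E' (f v) y} = f ` {y\<in>S. y \<noteq> v \<and> \<not> E v y}"
    using Split by (auto simp: inj_on_def)
  moreover have "avail_tree E' (f ` {y\<in>S. y \<noteq> v \<and> \<not> E v y}) (map_mtree f t')"
    using Split by (intro Split.IH) (auto simp: inj_on_def)
  moreover have "f ` S - {f v} = f ` (S - {v})" using Split by (auto simp: inj_on_def)
  moreover have "avail_tree E' (f ` (S - {v})) (map_mtree f t)"
    using Split by (intro Split.IH) (auto simp: inj_on_def)
  ultimately show ?case using Split by (auto simp: inj_on_def)
qed auto

definition is_path :: "('v \<Rightarrow> 'v \<Rightarrow> bool) \<Rightarrow> 'v list \<Rightarrow> bool" where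
  "is_path E xs \<longleftrightarrow> distinct xs \<and> (\<forall>i<length xs. \<forall>j<length xs. E (xs!i) (xs!j) \<longleftrightarrow> i = Suc j \<or> j = Suc i)"

lemma is_path_rev: "is_path E xs \<Longrightarrow> is_path E (rev xs)"
proof -
  assume p: "is_path E xs"
  have "E (rev xs!i) (rev xs!j) \<longleftrightarrow> i = Suc j \<or> j = Suc i" if "i < length xs" "j < length xs" for i j
  proof -
    let ?i = "length xs - Suc i" and ?j = "length xs - Suc j"
    have "E (xs ! ?i) (xs ! ?j) \<longleftrightarrow> ?i = Suc ?j \<or> ?j = Suc ?i"
    proof -
      have "?i < length xs" "?j < length xs" using that by linarith+
      then show ?thesis using p unfolding is_path_def by blast
    qed
    moreover have "(?i = Suc ?j \<or> ?j = Suc ?i) \<longleftrightarrow> i = Suc j \<or> j = Suc i" using that by auto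
    ultimately show ?thesis using that by (simp only: rev_nth)
  qed
  then show "is_path E (rev xs)" using p by (simp add: is_path_def)
qed

lemma is_path_step:
  assumes "is_path E (x # y # zs)"
  shows "is_path E (drop 1 zs)" "\<forall>w\<in>set (x#y#zs). E x w \<longleftrightarrow> w = y"
    "{w\<in>set (x#y#zs). w \<noteq> y \<and> \<not> E y w} = set (drop 1 zs)"
proof -
  let ?l = "x # y # zs"
  have E: "E (?l!i) (?l!j) \<longleftrightarrow> i = Suc j \<or> j = Suc i" if "i < length ?l" "j < length ?l" for i j
    using assms that unfolding is_path_def by blast
  have d: "distinct ?l" using assms unfolding is_path_def by blast
  have "E (drop 1 zs!i) (drop 1 zs!j) \<longleftrightarrow> i = Suc j \<or> j = Suc i"
    if "i < length (drop 1 zs)" "j < length (drop 1 zs)" for i j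
  proof -
    have "drop 1 zs!i = ?l!(i+3)" "drop 1 zs!j = ?l!(j+3)" using that by (simp_all add: eval_nat_numeral)
    moreover have "i + 3 < length ?l" "j + 3 < length ?l" using that by auto
    ultimately show ?thesis using E[of "i+3" "j+3"] by (simp only:) linarith
  qed
  then show "is_path E (drop 1 zs)" using d unfolding is_path_def by (simp add: distinct_drop)
  have x: "E x (?l!j) \<longleftrightarrow> j = 1" if "j < length ?l" for j
    using E[of 0 j, OF _ that] by (simp only: nth_Cons_0 length_Cons zero_less_Suc simp_thms) linarith
  have jy: "?l!j = y \<longleftrightarrow> j = 1" if "j < length ?l" for j
    using nth_eq_iff_index_eq[OF d that, of 1] by simp
  show "\<forall>w\<in>set (x#y#zs). E x w \<longleftrightarrow> w = y"
  proof
    fix w assume "w \<in> set ?l"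
    then obtain j where j: "j < length ?l" and w: "?l!j = w" unfolding in_set_conv_nth by blast
    show "E x w \<longleftrightarrow> w = y" using x[OF j] jy[OF j] unfolding w by (rule trans[OF _ sym])
  qed
  have y: "E y (?l!j) \<longleftrightarrow> j = 0 \<or> j = 2" if "j < length ?l" for j
    using E[of 1 j, OF _ that] by (simp only: One_nat_def nth_Cons_Suc nth_Cons_0 length_Cons Suc_less_eq zero_less_Suc simp_thms) linarith
  have yx: "E y x" using y[of 0] by simp
  have yy: "\<not> E y y" using y[of 1] by simp
  show "{w\<in>set (x#y#zs). w \<noteq> y \<and> \<not> E y w} = set (drop 1 zs)"
  proof (cases zs)
    case Nil
    then show ?thesis using yx by auto
  next
    case (Cons z ws)
    have "E y z" using y[of 2] Cons by simp
    moreover have "\<not> E y w" if wm: "w \<in> set ws" for w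
    proof -
      obtain i where "i < length ws" "ws!i = w" using wm unfolding in_set_conv_nth by blast
      then have i: "i + 3 < length ?l" and w: "?l!(i+3) = w" by (simp_all add: Cons eval_nat_numeral)
      show ?thesis using y[OF i] unfolding w by simp
    qed
    moreover have "y \<noteq> z" "y \<notin> set ws" using d Cons by auto
    ultimately show ?thesis using yx yy Cons by auto
  qed
qed

lemma avail_path_tree: "path_tree xs t \<Longrightarrow> is_path E xs \<Longrightarrow> avail_tree E (set xs) t"
proof (induction rule: path_tree.induct)
  case (step zs t x y)
  show ?case using is_path_step[OF step.prems] step.IH by simp
next
  case (isolated x) then show ?case by (auto simp: is_path_def)
qed (auto simp: is_path_rev)

lemma path_tree_peel: "path_tree xs (peel xs)"
  by (induction xs rule: peel.induct) (auto intro: path_tree.intros(1-3))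

lemma avail_paths_tree: "paths_tree xss t \<Longrightarrow> \<forall>xs\<in>set xss. is_path E xs \<Longrightarrow>
   (\<And>i j x y. i < length xss \<Longrightarrow> j < length xss \<Longrightarrow> i \<noteq> j \<Longrightarrow> x \<in> set (xss!i) \<Longrightarrow> y \<in> set (xss!j) \<Longrightarrow> x \<noteq> y \<and> \<not> E x y)
   \<Longrightarrow> avail_tree E (\<Union>xs\<in>set xss. set xs) t"
proof (induction rule: paths_tree.induct)
  case (Cons xs t xss s)
  have "avail_tree E (\<Union>xs\<in>set xss. set xs) s"
    using Cons.prems(1) Cons.prems(2)[of "Suc _" "Suc _"] by (intro Cons.IH) auto
  moreover have "x \<noteq> y \<and> \<not> E x y" if xy: "x \<in> set xs" "y \<in> (\<Union>xs\<in>set xss. set xs)" for x y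
  proof -
    obtain i where "i < length xss" "y \<in> set (xss!i)" using xy(2) by (metis UN_E in_set_conv_nth)
    then show ?thesis using xy(1) Cons.prems(2)[of 0 "Suc i" x y] by simp
  qed
  ultimately have "avail_tree E (set xs \<union> (\<Union>xs\<in>set xss. set xs)) (graft t s)"
    using Cons avail_path_tree by (intro avail_graft) auto
  then show ?case by simp
qed auto

lemma avail_peel:
  "length xs mod 3 = 0 \<Longrightarrow> is_path E xs \<Longrightarrow> avail_tree E S s \<Longrightarrow> set xs \<inter> S = {} \<Longrightarrow>
   (\<And>i y. i < length xs - 1 \<Longrightarrow> y \<in> S \<Longrightarrow> \<not> E (xs!i) y) \<Longrightarrow> avail_tree E (set xs \<union> S) (graft (peel xs) s)"
proof (induction xs rule: peel.induct)
  case (1 x y zs)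
  then obtain z ws where zs: "zs = z # ws" by (cases zs) auto
  have "avail_tree E (set ws \<union> S) (graft (peel ws) s)"
    using 1 is_path_step(1)[OF 1(3)] 1(6)[of "Suc (Suc (Suc _))"] by (auto simp: zs)
  moreover have "\<not> E x w" "\<not> E y w" if "w \<in> S" for w
    using 1(6)[of 0 w] 1(6)[of 1 w] that by (auto simp: zs)
  moreover have "{w. (w = x \<or> w = y \<or> w = z \<or> w \<in> set ws \<or> w \<in> S) \<and> w \<noteq> y \<and> \<not> E y w} = set ws \<union> S"
    using is_path_step(3)[OF 1(3)] 1(5) calculation by (auto simp: zs)
  ultimately show ?case using is_path_step(2)[OF 1(3)] 1(5) by (auto simp: zs)
qed auto

fun star_adj :: "vertex \<Rightarrow> vertex \<Rightarrow> bool" where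
  "star_adj End_a (Inner j k) \<longleftrightarrow> k = 1"
| "star_adj (Inner j k) End_a \<longleftrightarrow> k = 1"
| "star_adj (Inner j k) (Inner j' k') \<longleftrightarrow> j = j' \<and> (k = Suc k' \<or> k' = Suc k)"
| "star_adj _ _ \<longleftrightarrow> False"

definition star_verts :: "nat \<Rightarrow> nat \<Rightarrow> vertex set" where
  "star_verts m n = {End_a} \<union> {Inner j k | j k. j \<in> {1..m} \<and> k \<in> {1..n}}"

lemma is_path_tendril: "is_path star_adj (map (Inner j) [i..<n])"
  by (auto simp: is_path_def distinct_map inj_on_def)

lemma avail_tendrils:
  assumes "tendril_order m js" "paths_tree (map (\<lambda>j. map (Inner j) [i..<n]) js) t"
  shows "avail_tree star_adj {Inner j k | j k. j \<in> {1..m} \<and> k \<in> {i..<n}} t"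
proof -
  have "avail_tree star_adj (\<Union>xs\<in>set (map (\<lambda>j. map (Inner j) [i..<n]) js). set xs) t"
    using assms is_path_tendril by (intro avail_paths_tree) (auto simp: nth_eq_iff_index_eq)
  moreover have "(\<Union>xs\<in>set (map (\<lambda>j. map (Inner j) [i..<n]) js). set xs) = {Inner j k | j k. j \<in> {1..m} \<and> k \<in> {i..<n}}"
    using assms by auto
  ultimately show ?thesis by simp
qed

lemma avail_star: "star_tree m n t \<Longrightarrow> avail_tree star_adj (star_verts m n) t"
proof (induction rule: star_tree.induct)
  case (mod_0 n m js)
  have "distinct js \<Longrightarrow> avail_tree star_adj ({End_a} \<union> {Inner j k | j k. j \<in> set js \<and> k \<in> {1..n}}) (foldr (\<lambda>j. graft (peel (map (Inner j) (rev [1..<n+1])))) js (Free End_a))" for js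
  proof (induction js)
    case (Cons j js)
    let ?S = "{End_a} \<union> {Inner j k | j k. j \<in> set js \<and> k \<in> {1..n}}"
    let ?xs = "map (Inner j) (rev [1..<n+1])"
    have nth: "?xs!i = Inner j (n - i)" if "i < n" for i using that by (simp add: rev_nth del: upt_Suc)
    have "avail_tree star_adj (set ?xs \<union> ?S) (graft (peel ?xs) (foldr (\<lambda>j. graft (peel (map (Inner j) (rev [1..<n+1])))) js (Free End_a)))"
    proof (rule avail_peel)
      show "is_path star_adj ?xs" using is_path_rev[OF is_path_tendril[of j 1 "n+1"]] by (simp add: rev_map)
      fix i y assume i: "i < length ?xs - 1" and y: "y \<in> ?S"
      have "i < n" and "n - i \<noteq> 1" using i by (simp_all del: upt_Suc)
      then show "\<not> star_adj (?xs!i) y" unfolding nth[OF \<open>i < n\<close>] using Cons.prems y by auto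
    qed (use mod_0 Cons in auto)
    moreover have "set ?xs \<union> ?S = {End_a} \<union> {Inner j' k | j' k. j' \<in> set (j#js) \<and> k \<in> {1..n}}" by auto
    ultimately show ?case by simp
  qed auto
  from this[of js] show ?case using mod_0 by (simp add: star_verts_def)
next
  case (mod_not_0 n m js t js' t')
  have "star_verts m n - {End_a} = {Inner j k | j k. j \<in> {1..m} \<and> k \<in> {1..<n+1}}" by (auto simp: star_verts_def)
  moreover have "{y\<in>star_verts m n. y \<noteq> End_a \<and> \<not> star_adj End_a y} = {Inner j k | j k. j \<in> {1..m} \<and> k \<in> {2..<n+1}}"
    by (auto simp: star_verts_def)
  ultimately show ?case using avail_tendrils[OF mod_not_0(2,3)] avail_tendrils[OF mod_not_0(4,5)]
    by (simp del: upt_Suc) (simp add: star_verts_def)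
qed

fun Delta_adj :: "nat \<Rightarrow> vertex \<Rightarrow> vertex \<Rightarrow> bool" where
  "Delta_adj n End_b (Inner j k) \<longleftrightarrow> k = n + 1"
| "Delta_adj n (Inner j k) End_b \<longleftrightarrow> k = n + 1"
| "Delta_adj n (Extra k) (Inner j i) \<longleftrightarrow> i = k \<or> i = k + 1"
| "Delta_adj n (Inner j i) (Extra k) \<longleftrightarrow> i = k \<or> i = k + 1"
| "Delta_adj n x y \<longleftrightarrow> star_adj x y"

definition Delta_verts :: "nat \<Rightarrow> nat \<Rightarrow> vertex set" where
  "Delta_verts m n = star_verts m (n + 1) \<union> {End_b} \<union> Extra ` {1..n}"

lemma fst_Delta: "fst (Delta m n) = Delta_verts m n"
  by (auto simp: Delta_def Yhat_def Delta_verts_def star_verts_def)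

lemma Delta_edges:
  "e \<in> snd (Delta m n) \<longleftrightarrow> (\<exists>j\<in>{1..m}. e = {End_a, Inner j 1} \<or> e = {Inner j (n+1), End_b} \<or>
     (\<exists>k\<in>{1..n}. e = {Inner j k, Inner j (k+1)} \<or> e = {Extra k, Inner j k} \<or> e = {Extra k, Inner j (k+1)}))"
proof -
  have "(\<exists>k\<in>{0..n+1}. P k) \<longleftrightarrow> P 0 \<or> P (n+1) \<or> (\<exists>k\<in>{1..n}. P k)" for P :: "nat \<Rightarrow> bool"
  proof -
    have "{0..n+1} = insert 0 (insert (n+1) {1..n})" by auto
    then show ?thesis by (simp only:) blast
  qed
  note this[of "\<lambda>k. e = {path_vertex (n + 1) j k, path_vertex (n + 1) j (k + 1)}" for j]
  then have "e \<in> snd (Yhat m (n+1)) \<longleftrightarrow> (\<exists>j\<in>{1..m}. e = {path_vertex (n + 1) j 0, path_vertex (n + 1) j (0 + 1)} \<or>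
     e = {path_vertex (n + 1) j (n + 1), path_vertex (n + 1) j (n + 1 + 1)} \<or>
     (\<exists>k\<in>{1..n}. e = {path_vertex (n + 1) j k, path_vertex (n + 1) j (k + 1)}))"
    unfolding Yhat_def snd_conv by blast
  also have "\<dots> \<longleftrightarrow> (\<exists>j\<in>{1..m}. e = {End_a, Inner j 1} \<or> e = {Inner j (n+1), End_b} \<or>
     (\<exists>k\<in>{1..n}. e = {Inner j k, Inner j (k+1)}))"
    by (intro bex_cong arg_cong2[of _ _ _ _ "(\<or>)"] refl) (auto simp: path_vertex_def)
  finally have Y: "e \<in> snd (Yhat m (n+1)) \<longleftrightarrow> (\<exists>j\<in>{1..m}. e = {End_a, Inner j 1} \<or> e = {Inner j (n+1), End_b} \<or>
     (\<exists>k\<in>{1..n}. e = {Inner j k, Inner j (k+1)}))" .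
  have S: "e \<in> {f j k | j k. j \<in> {1..m} \<and> k \<in> {1..n}} \<longleftrightarrow> (\<exists>j\<in>{1..m}. \<exists>k\<in>{1..n}. e = f j k)" for f by blast
  show ?thesis unfolding Delta_def snd_conv Un_iff Y S bex_disj_distrib by argo
qed

lemma Delta_adj_iff:
  assumes "x \<in> Delta_verts m n" "y \<in> Delta_verts m n"
  shows "{x,y} \<in> snd (Delta m n) \<longleftrightarrow> Delta_adj n x y"
  using assms unfolding Delta_edges
  by (cases x; cases y; force simp: Delta_verts_def star_verts_def doubleton_eq_iff)

lemma simple_Delta: "simple_graph (Delta m n)"
proof -
  have "finite (Delta_verts m n)"
  proof -
    have "{Inner j k |j k. j \<in> {1..m} \<and> k \<in> {1..n + 1}} = (\<lambda>(j,k). Inner j k) ` ({1..m} \<times> {1..n+1})" by auto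
    then show ?thesis unfolding Delta_verts_def star_verts_def by simp
  qed
  moreover have "e \<subseteq> Delta_verts m n \<and> card e = 2" if "e \<in> snd (Delta m n)" for e
    using that unfolding Delta_edges by (auto simp: Delta_verts_def star_verts_def)
  ultimately show ?thesis by (auto simp: simple_graph_def fst_Delta)
qed

lemma avail_Yhat:
  assumes "Yhat_tree m (n + 1) t"
  shows "avail_tree (Delta_adj n) (insert End_b (star_verts m (n + 1))) t"
proof -
  obtain t0 t1 where t: "t = Split End_b t0 t1" "star_tree m (n + 1) t0" "star_tree m n t1"
    using assms by (auto elim: Yhat_tree.cases)
  have "avail_tree (Delta_adj n) (star_verts m (n+1)) t0" by (rule avail_cong[OF avail_star[OF t(2)]]) (auto simp: star_verts_def)
  moreover have "avail_tree (Delta_adj n) (star_verts m n) t1" by (rule avail_cong[OF avail_star[OF t(3)]]) (auto simp: star_verts_def)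
  moreover have "insert End_b (star_verts m (n + 1)) - {End_b} = star_verts m (n+1)" by (auto simp: star_verts_def)
  moreover have "{y \<in> insert End_b (star_verts m (n + 1)). y \<noteq> End_b \<and> \<not> Delta_adj n End_b y} = star_verts m n" by (auto simp: star_verts_def)
  ultimately show ?thesis using t by (simp del: Delta_adj.simps)
qed

lemma inj_shift: "inj_on (shift s) (Delta_verts m n)"
  by (auto simp: inj_on_def Delta_verts_def star_verts_def)

lemma Delta_adj_shift: "x \<in> Delta_verts m n \<Longrightarrow> y \<in> Delta_verts m n \<Longrightarrow> Delta_adj (s + n) (shift s x) (shift s y) = Delta_adj n x y"
  by (cases x; cases y) (auto simp: Delta_verts_def star_verts_def)

lemma avail_comb:
  "comb_tree m n t \<Longrightarrow> avail_tree (Delta_adj n) (Delta_verts m n) t"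
  "comb_branch m n k t' \<Longrightarrow> 1 \<le> k \<Longrightarrow> k \<le> n \<Longrightarrow>
     avail_tree (Delta_adj n) {y \<in> Delta_verts m n - Extra ` {1..k}. \<not> Delta_adj n (Extra k) y} t'"
proof (induction rule: comb_tree_comb_branch.inducts)
  case (Delta_0 t)
  then show ?case using avail_Yhat[of m 0 t] by (simp add: Delta_verts_def)
next
  case (spine n t br)
  have "i \<le> n \<Longrightarrow> avail_tree (Delta_adj n) (Delta_verts m n - Extra ` {1..n-i}) (foldr (\<lambda>k s. Split (Extra k) s (br k)) [n-i+1..<n+1] t)" for i
  proof (induction i)
    case 0
    have "Delta_verts m n - Extra ` {1..n} = insert End_b (star_verts m (n + 1))" by (auto simp: Delta_verts_def star_verts_def)
    then show ?case using avail_Yhat[OF spine(2)] by simp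
  next
    case (Suc i)
    let ?k = "n - i"
    have eq: "n - Suc i + 1 = ?k" using Suc.prems by simp
    have l: "[?k..<n+1] = ?k # [?k+1..<n+1]" using Suc.prems by (subst upt_conv_Cons) auto
    have "avail_tree (Delta_adj n) (Delta_verts m n - Extra ` {1..?k}) (foldr (\<lambda>k s. Split (Extra k) s (br k)) [?k+1..<n+1] t)"
      using Suc by simp
    moreover have I: "Extra ` {1..?k} = insert (Extra ?k) (Extra ` {1..n - Suc i})"
    proof -
      have "{1..?k} = insert ?k {1..n - Suc i}" using Suc.prems by auto
      then show ?thesis by simp
    qed
    moreover have "Delta_verts m n - Extra ` {1..?k} = Delta_verts m n - Extra ` {1..n - Suc i} - {Extra ?k}"
      unfolding I by auto
    moreover have "avail_tree (Delta_adj n) {y \<in> Delta_verts m n - Extra ` {1..?k}. \<not> Delta_adj n (Extra ?k) y} (br ?k)"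
      using spine(3) Suc.prems by auto
    moreover have "{y \<in> Delta_verts m n - Extra ` {1..?k}. \<not> Delta_adj n (Extra ?k) y} = {y \<in> Delta_verts m n - Extra ` {1..n - Suc i}. y \<noteq> Extra ?k \<and> \<not> Delta_adj n (Extra ?k) y}"
      unfolding I by auto
    moreover have "Extra ?k \<in> Delta_verts m n - Extra ` {1..n - Suc i}" using Suc.prems by (auto simp: Delta_verts_def)
    ultimately show ?case unfolding eq l by (simp del: Delta_adj.simps upt_Suc)
  qed
  from this[of n] show ?case by simp
next
  case (first n)
  then show ?case by (auto simp: Delta_verts_def star_verts_def)
next
  case (last n)
  then show ?case by (auto simp: Delta_verts_def star_verts_def)
next
  case (middle k n s t)
  let ?s = "k + 1" and ?n = "n - (k + 1)"
  have n: "?s + ?n = n" using middle by auto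
  have "avail_tree (Delta_adj (?s + ?n)) (shift ?s ` Delta_verts m ?n) (map_mtree (shift ?s) t)"
    by (rule avail_map[OF middle(5) inj_shift Delta_adj_shift])
  then have 1: "avail_tree (Delta_adj n) (shift ?s ` Delta_verts m ?n) (map_mtree (shift ?s) t)" unfolding n .
  have 2: "avail_tree (Delta_adj n) (star_verts m (k-1)) s" by (rule avail_cong[OF avail_star[OF middle(3)]]) (auto simp: star_verts_def)
  have "avail_tree (Delta_adj n) (star_verts m (k-1) \<union> shift ?s ` Delta_verts m ?n) (graft s (map_mtree (shift ?s) t))"
    using middle(1,2) by (intro avail_graft 1 2) (auto simp: Delta_verts_def star_verts_def)
  moreover have "star_verts m (k-1) \<union> shift ?s ` Delta_verts m ?n = {y \<in> Delta_verts m n - Extra ` {1..k}. \<not> Delta_adj n (Extra k) y}" (is "?L = ?R")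
  proof (rule set_eqI)
    fix x
    show "x \<in> ?L \<longleftrightarrow> x \<in> ?R"
    proof (cases x)
      case (Inner j i)
      have "Inner j i \<in> shift ?s ` Delta_verts m ?n \<longleftrightarrow> j \<in> {1..m} \<and> ?s < i \<and> i \<le> n + 1"
        using middle(1,2) by (auto simp: Delta_verts_def star_verts_def image_iff intro!: exI[of _ "Inner j (i - ?s)"] bexI[of _ "Inner j (i - ?s)"])
      then show ?thesis using middle(1,2) by (auto simp: Inner Delta_verts_def star_verts_def)
    next
      case (Extra i)
      have "Extra i \<in> shift ?s ` Delta_verts m ?n \<longleftrightarrow> ?s \<le> i \<and> i \<le> n"
      proof (cases "i = ?s")
        case True
        then show ?thesis using middle(1,2) by (auto simp: Delta_verts_def star_verts_def image_iff intro!: bexI[of _ End_a])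
      next
        case False
        then show ?thesis using middle(1,2) by (auto simp: Delta_verts_def star_verts_def image_iff intro!: bexI[of _ "Extra (i - ?s)"])
      qed
      then show ?thesis using middle(1,2) by (auto simp: Extra Delta_verts_def star_verts_def)
    qed (use middle(1,2) in \<open>auto simp: Delta_verts_def star_verts_def image_iff\<close>)
  qed
  ultimately show ?case by simp
qed

theorem comb_tree_matching_tree:
  assumes "comb_tree m n t" shows "matching_tree (Delta m n) {} {} t"
proof (rule avail_matching_tree[OF simple_Delta])
  show "avail_tree (\<lambda>x y. {x, y} \<in> snd (Delta m n)) (fst (Delta m n) - ({} \<union> {})) t"
    using avail_cong[OF avail_comb(1)[OF assms], of "\<lambda>x y. {x, y} \<in> snd (Delta m n)"] Delta_adj_iff by (simp add: fst_Delta)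
qed (auto simp: Ind_def)

lemma star_tree_exists: "\<exists>t. star_tree m n t"
proof -
  have p: "\<exists>t. paths_tree xss t" for xss :: "vertex list list"
    by (induction xss) (auto intro: paths_tree.intros path_tree_peel)
  have o: "tendril_order m [1..<m+1]" by auto
  show ?thesis
  proof (cases "n mod 3 = 0")
    case True
    show ?thesis by (rule exI, rule star_tree.mod_0[OF True o])
  next
    case False
    obtain t where t: "paths_tree (map (\<lambda>j. map (Inner j) [1..<n+1]) [1..<m+1]) t" using p by blast
    obtain t' where t': "paths_tree (map (\<lambda>j. map (Inner j) [2..<n+1]) [1..<m+1]) t'" using p by blast
    show ?thesis by (rule exI, rule star_tree.mod_not_0[OF False o t o t'])
  qed
qed

theorem comb_tree_exists: "\<exists>t. comb_tree m n t"
proof (induction n rule: less_induct)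
  case (less n)
  have Y: "\<exists>t. Yhat_tree m n t" for n using star_tree_exists Yhat_tree.intros by metis
  have "\<exists>t. comb_branch m n k t" if k: "1 \<le> k" "k \<le> n" for k
  proof -
    consider "k = 1" | "k = n" | "2 \<le> k" "k \<le> n - 1" using k by linarith
    then show ?thesis
    proof cases
      case 1
      show ?thesis unfolding 1 by (rule exI, rule comb_tree_comb_branch.first)
    next
      case 2
      show ?thesis unfolding 2 by (rule exI, rule comb_tree_comb_branch.last)
    next
      case 3
      obtain s where s: "star_tree m (k - 1) s" using star_tree_exists by blast
      have "n - (k + 1) < n" using k by linarith
      then obtain t where t: "comb_tree m (n - (k + 1)) t" using less by blast
      show ?thesis by (rule exI, rule comb_tree_comb_branch.middle[OF 3 s t])
    qed
  qed
  then obtain br where br: "\<forall>k\<in>{1..n}. comb_branch m n k (br k)" by (metis atLeastAtMost_iff)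
  show ?case
  proof (cases "n = 0")
    case True
    obtain t where t: "Yhat_tree m 1 t" using Y by blast
    show ?thesis unfolding True by (rule exI, rule comb_tree_comb_branch.Delta_0[OF t])
  next
    case False
    then have n: "1 \<le> n" by simp
    obtain t where t: "Yhat_tree m (n + 1) t" using Y by blast
    show ?thesis by (rule exI, rule comb_tree_comb_branch.spine[OF n t br])
  qed
qed

end

theory Submission
  imports Defs
begin

text \<open>
  The critical cells of a matching tree have as many vertices as there are inclusion steps on the
  path to their leaf, so the possible sizes are computed from the tree alone. A path on \<open>\<ell>\<close>
  vertices yields no cell if \<open>\<ell> \<equiv> 1 mod 3\<close> and otherwise only the size \<open>\<lceil>\<ell>/3\<rceil>\<close>; hence
  \<open>Y\<^sup>m\<^sub>n\<close> yields no cell, only size \<open>mq + 1\<close>, or only size \<open>m(q + 1)\<close>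
  for \<open>n = 3q, 3q + 1, 3q + 2\<close>. The lower bound \<open>d_min m n + 1\<close> on the sizes for \<open>Delta m n\<close> then follows by
  induction along the comb: a cell of the \<open>k\<close>-th middle branch has one vertex more than a cell for
  the star with \<open>k - 1\<close> edges per tendril and one for \<open>Delta m (n - (k + 1))\<close> together.
\<close>

text \<open>Only vertices chosen below the current node are counted, without multiplicity. A
  \<open>Leaf\<close> gives 0 with no check that its node is nonempty, so the set may be larger than
  that of the actual sizes; lower bounds carry over.\<close>

fun cell_sizes :: "'v mtree \<Rightarrow> nat set" where
  "cell_sizes Leaf = {0}"
| "cell_sizes (Free p) = {}"
| "cell_sizes (Pivot p v t) = Suc ` cell_sizes t"
| "cell_sizes (Split v t t') = cell_sizes t \<union> Suc ` cell_sizes t'"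

text \<open>In a valid tree each chosen \<open>v\<close> lies outside \<open>A\<close>, so every
  inclusion raises the cardinality by exactly one.\<close>

lemma card_critical_cell:
  "matching_tree G A B t \<Longrightarrow> finite A \<Longrightarrow>
    F \<in> critical_cells G A B t \<Longrightarrow> \<exists>c\<in>cell_sizes t. card F = card A + c"
proof (induction t arbitrary: A B)
  case (Pivot p v t)
  have "v \<notin> A" using Pivot.prems(1) by auto
  moreover have "\<exists>c\<in>cell_sizes t. card F = card (A \<union> {v}) + c"
    using Pivot.prems by (intro Pivot.IH[of "A \<union> {v}" "B \<union> nbrs G v"]) simp_all
  ultimately show ?case using Pivot.prems(2) by simp
next
  case (Split v t t')
  have v: "v \<notin> A" using Split.prems(1) by auto
  consider "F \<in> critical_cells G A (B \<union> {v}) t"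
    | "F \<in> critical_cells G (A \<union> {v}) (B \<union> nbrs G v) t'"
    using Split.prems(3) by auto
  then show ?case
  proof cases
    case 1
    then have "\<exists>c\<in>cell_sizes t. card F = card A + c"
      using Split.prems by (intro Split.IH(1)[of A "B \<union> {v}"]) simp_all
    then show ?thesis by auto
  next
    case 2
    then have "\<exists>c\<in>cell_sizes t'. card F = card (A \<union> {v}) + c"
      using Split.prems by (intro Split.IH(2)[of "A \<union> {v}" "B \<union> nbrs G v"]) simp_all
    then show ?thesis using v Split.prems(2) by auto
  qed
qed (auto split: if_splits)

lemma cell_sizes_graft:
  "cell_sizes (graft t s) = (\<Union>a\<in>cell_sizes t. (+) a ` cell_sizes s)"
  by (induction t) (simp_all add: image_UN image_image image_Un UN_Un)

lemma cell_sizes_map_mtree: "cell_sizes (map_mtree f t) = cell_sizes t"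
  by (induction t) auto

text \<open>A pivot spends three vertices on one chosen vertex and keeps the length mod 3. A
  remainder of two costs one more pivot, while a remainder of one is a free vertex.\<close>

lemma cell_sizes_path_tree:
  "path_tree xs t \<Longrightarrow>
    cell_sizes t = (if length xs mod 3 = 1 then {} else {(length xs + 2) div 3})"
proof (induction rule: path_tree.induct)
  case (step zs t x y)
  show ?case
  proof (cases zs)
    case (Cons z ws)
    then show ?thesis using step.IH by (auto simp: mod_Suc)
  qed (use step.IH in simp)
qed auto

text \<open>Sizes add up under grafting. The guard is there because with no paths the tree is a
  \<open>Leaf\<close>, whatever \<open>l\<close> is.\<close>

lemma cell_sizes_paths_tree:
  "paths_tree xss t \<Longrightarrow> \<forall>xs\<in>set xss. length xs = l \<Longrightarrow>
    cell_sizes t = (if l mod 3 = 1 \<and> xss \<noteq> [] then {} else {length xss * ((l + 2) div 3)})"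
proof (induction rule: paths_tree.induct)
  case (Cons xs t xss s)
  then show ?case using cell_sizes_path_tree[OF Cons.hyps(1)]
    by (auto simp: cell_sizes_graft)
qed simp

text \<open>When the centre is split, just one branch survives: the tendrils have \<open>n\<close>
  vertices if it is excluded and \<open>n - 1\<close> if it is chosen, and one of these is 1 mod 3.
  As \<open>1 \<le> m\<close>, there is a tendril to kill that branch.\<close>

lemma cell_sizes_star_tree:
  assumes "star_tree m n t" "1 \<le> m"
  shows "cell_sizes t =
    (if n mod 3 = 0 then {} else if n mod 3 = 1 then {m * (n div 3) + 1} else {m * (n div 3 + 1)})"
  using assms
proof (induction rule: star_tree.induct)
  case (mod_0 n m js)
  have "cell_sizes (foldr (\<lambda>j. graft (g j)) js (Free p)) = {}" for js g and p :: vertex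
    by (induction js) (auto simp: cell_sizes_graft)
  then show ?case using mod_0 by (simp del: upt_Suc)
next
  case (mod_not_0 n m js t js' t')
  have js: "length js = m" "length js' = m"
    using mod_not_0(2,4) by (metis card_atLeastAtMost diff_Suc_1 distinct_card)+
  then have ne: "js \<noteq> []" "js' \<noteq> []" using mod_not_0.prems by auto
  have t: "cell_sizes t = (if n mod 3 = 1 then {} else {m * ((n + 2) div 3)})"
    using cell_sizes_paths_tree[OF mod_not_0(3), of n] ne js by (simp del: upt_Suc)
  have t': "cell_sizes t' = (if (n - 1) mod 3 = 1 then {} else {m * ((n + 1) div 3)})"
    using cell_sizes_paths_tree[OF mod_not_0(5), of "n - 1"] ne js mod_not_0(1)
    by (cases n) (simp_all del: upt_Suc)
  consider "n mod 3 = 1" | "n mod 3 = 2" using mod_not_0(1) by linarith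
  then show ?case
  proof cases
    case 1
    then obtain q where q: "n = 3 * q + 1" by (metis mult_div_mod_eq)
    then have "(n - 1) mod 3 = 0" "(n + 1) div 3 = q" "n div 3 = q" by presburger+
    then show ?thesis using t t' 1 by simp
  next
    case 2
    then obtain q where q: "n = 3 * q + 2" by (metis mult_div_mod_eq)
    have "(n - 1) mod 3 = 1" by (simp add: q)
    moreover have "(n + 2) div 3 = q + 1" "n div 3 = q"
      by (rule div_nat_eqI; use q in simp)+
    ultimately show ?thesis using t t' 2 by simp
  qed
qed

text \<open>This is \<open>d_min m n + 1\<close>, a number of vertices instead of a dimension,
  written without floors.\<close>

definition c_min :: "nat \<Rightarrow> nat \<Rightarrow> nat" where
  "c_min m n = 2 * (n div 3) + 1 + (if n mod 3 = 2 then m else n mod 3)"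

lemma nat_mod_3_cases:
  obtains q :: nat where "n = 3 * q" | q where "n = 3 * q + 1" | q where "n = 3 * q + 2"
proof -
  have "n = 3 * (n div 3) \<or> n = 3 * (n div 3) + 1 \<or> n = 3 * (n div 3) + 2" by presburger
  then show ?thesis using that by blast
qed

lemma d_min_c_min: "d_min m n = int (c_min m n) - 1"
proof -
  have fl: "\<lfloor>real a / 3\<rfloor> = int (a div 3)" for a
    using floor_divide_of_nat_eq[of a 3, where 'a = real] by simp
  have ex: "(\<exists>k::int. int n = 3 * k \<or> int n = 3 * k + 1) \<longleftrightarrow> n mod 3 \<noteq> 2" by presburger
  show ?thesis
  proof (cases "n mod 3 = 2")
    case True
    then have "(n - 1) div 3 = n div 3" "1 \<le> n" by presburger+
    then show ?thesis using True fl[of "n - 1"] by (simp add: d_min_def ex c_min_def of_nat_diff)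
  next
    case False
    have "(2 * n + 2) div 3 = 2 * (n div 3) + n mod 3"
    proof (cases n rule: nat_mod_3_cases)
      case (1 q)
      then have "(2 * n + 2) div 3 = 2 * q" "n div 3 = q" "n mod 3 = 0" by presburger+
      then show ?thesis by simp
    next
      case (2 q)
      then have "(2 * n + 2) div 3 = 2 * q + 1" "n div 3 = q" "n mod 3 = 1" by presburger+
      then show ?thesis by simp
    next
      case (3 q)
      then have "n mod 3 = 2" by presburger
      then show ?thesis using False by simp
    qed
    moreover have "\<lfloor>(2 * real n + 2) / 3\<rfloor> = int ((2 * n + 2) div 3)"
      using fl[of "2 * n + 2"] by (simp add: add.commute)
    ultimately show ?thesis using False by (simp add: d_min_def ex c_min_def)
  qed
qed

lemma c_min_simps:
  "c_min m (3 * q) = 2 * q + 1"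
  "c_min m (3 * q + 1) = 2 * q + 2"
  "c_min m (3 * q + 2) = 2 * q + m + 1"
proof -
  have "(3 * q + 1) mod 3 = 1" "(3 * q + 1) div 3 = q"
    "(3 * q + 2) mod 3 = 2" "(3 * q + 2) div 3 = q" by presburger+
  then show "c_min m (3 * q) = 2 * q + 1" "c_min m (3 * q + 1) = 2 * q + 2"
    "c_min m (3 * q + 2) = 2 * q + m + 1"
    unfolding c_min_def by simp_all
qed

lemma c_min_add_3_mult: "c_min m (3 * i + r) = 2 * i + c_min m r"
proof -
  have "(3 * i + r) mod 3 = r mod 3" "(3 * i + r) div 3 = i + r div 3" by simp_all
  then show ?thesis unfolding c_min_def by simp
qed

lemma c_min_le_Yhat:
  assumes m: "2 \<le> m" and t: "Yhat_tree m (n + 1) t" and c: "c \<in> cell_sizes t"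
  shows "c_min m n \<le> c"
proof -
  obtain t0 t1 where t01: "t = Split End_b t0 t1" "star_tree m (n + 1) t0" "star_tree m n t1"
    using t by (auto elim: Yhat_tree.cases)
  have m1: "1 \<le> m" using m by simp
  note c01 = cell_sizes_star_tree[OF t01(2) m1] cell_sizes_star_tree[OF t01(3) m1]
  show ?thesis
  proof (cases n rule: nat_mod_3_cases)
    case (1 q)
    have "(3 * q + 1) mod 3 = 1" "(3 * q + 1) div 3 = q" by presburger+
    then have "c = m * q + 1" using c c01 by (simp add: t01(1) 1)
    then show ?thesis using mult_le_mono1[OF m, of q] by (simp add: 1 c_min_simps)
  next
    case (2 q)
    have "(3 * q + 2) mod 3 = 2" "(3 * q + 2) div 3 = q"
      "(3 * q + 1) mod 3 = 1" "(3 * q + 1) div 3 = q" by presburger+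
    then have "c = m * (q + 1) \<or> c = m * q + 2" using c c01 by (auto simp: t01(1) 2)
    then show ?thesis using mult_le_mono1[OF m, of q] m
      \<comment> \<open>Both branches at \<open>b\<close> survive only for this residue; the second
        size includes \<open>b\<close> itself.\<close>
      unfolding 2 c_min_simps distrib_left mult_1_right by linarith
  next
    case (3 q)
    have "(3 * q + 2) mod 3 = 2" "(3 * q + 2) div 3 = q" "(3 * q + 3) mod 3 = 0" by presburger+
    then have "c = m * (q + 1) + 1" using c c01 by (auto simp: t01(1) 3)
    then show ?thesis using mult_le_mono1[OF m, of q]
      unfolding 3 c_min_simps by (simp add: algebra_simps)
  qed
qed

lemma c_min_le_middle:
  assumes m: "2 \<le> m" and k: "2 \<le> k" "k + 1 \<le> n"
    and s: "star_tree m (k - 1) s" "a \<in> cell_sizes s" and b: "c_min m (n - (k + 1)) \<le> b"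
  shows "c_min m n \<le> Suc (a + b)"
proof -
  obtain r where r: "n = k + 1 + r" using k le_Suc_ex by blast
  have rb: "c_min m r \<le> b" using b r by simp
  have m1: "1 \<le> m" using m by simp
  note a = cell_sizes_star_tree[OF s(1) m1]
  show ?thesis
  proof (cases "k - 1" rule: nat_mod_3_cases)
    case (1 i)
    then show ?thesis using a s(2) by simp
  next
    case (2 i)
    have "(3 * i + 1) mod 3 = 1" "(3 * i + 1) div 3 = i" by presburger+
    then have ai: "a = m * i + 1" using a[unfolded 2] s(2) by simp
    have "k = 3 * i + 2" using 2 k(1) by simp
    then have n: "n = 3 * (i + 1) + r" using r by simp
    have "c_min m n = 2 * (i + 1) + c_min m r"
      unfolding n by (rule c_min_add_3_mult)
    then show ?thesis using add_mono[OF mult_le_mono1[OF m, of i] rb] by (simp add: ai)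
  next
    case (3 i)
    have "(3 * i + 2) mod 3 = 2" "(3 * i + 2) div 3 = i" by presburger+
    then have ai: "a = m * i + m" using a[unfolded 3] s(2) by simp
    have "k = 3 * i + 3" using 3 k(1) by simp
    then have n: "n = 3 * (i + 1) + (r + 1)" using r by simp
    have "c_min m n = 2 * (i + 1) + c_min m (r + 1)"
      unfolding n by (rule c_min_add_3_mult)
    \<comment> \<open>Passing from \<open>r\<close> to \<open>r + 1\<close> changes
      \<open>c_min\<close> by 1, m - 1 or 2 - m, hence by at most m - 1. The summand m of
      \<open>a\<close> pays for this.\<close>
    moreover have "c_min m (r + 1) + 1 \<le> c_min m r + m"
    proof (cases r rule: nat_mod_3_cases)
      case (1 q)
      then show ?thesis using m by (simp only: c_min_simps)
    next
      case (2 q)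
      have "r + 1 = 3 * q + 2" using 2 by simp
      then show ?thesis using 2 by (simp only: c_min_simps)
    next
      case (3 q)
      have "r + 1 = 3 * (q + 1)" using 3 by simp
      then show ?thesis using 3 m by (simp only: c_min_simps)
    qed
    ultimately show ?thesis using add_mono[OF mult_le_mono1[OF m, of i] rb] by (simp add: ai)
  qed
qed

text \<open>The \<open>Suc\<close> in the branch bound stands for the vertex k, which is chosen by
  the split above the branch.\<close>

lemma c_min_le_comb:
  assumes m: "2 \<le> m"
  shows "comb_tree m n t \<Longrightarrow> \<forall>c\<in>cell_sizes t. c_min m n \<le> c"
    and "comb_branch m n k t' \<Longrightarrow> \<forall>c\<in>cell_sizes t'. c_min m n \<le> Suc c"
proof (induction rule: comb_tree_comb_branch.inducts)
  case (Delta_0 t)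
  then show ?case using c_min_le_Yhat[OF m, of 0 t] by simp
next
  case (spine n t br)
  \<comment> \<open>An arbitrary list of spine vertices makes the induction over
    \<open>foldr\<close> go through.\<close>
  have "set ks \<subseteq> {1..n} \<Longrightarrow>
    \<forall>c\<in>cell_sizes (foldr (\<lambda>k s. Split (Extra k) s (br k)) ks t). c_min m n \<le> c" for ks
    using c_min_le_Yhat[OF m spine(2)] spine(3) by (induction ks) auto
  from this[of "[1..<n+1]"] show ?case by (simp add: atLeastLessThanSuc_atLeastAtMost del: upt_Suc)
next
  case (middle k n s t)
  have "k + 1 \<le> n" using middle(1,2) by linarith
  then show ?case using middle(5) c_min_le_middle[OF m middle(1) _ middle(3)]
    by (auto simp: cell_sizes_graft cell_sizes_map_mtree)
qed auto

theorem theorem5p1: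
  fixes m n :: nat
  assumes "m \<ge> 2"
  shows "(\<forall>t d. comb_tree m n t \<and> 0 \<le> d \<and> d < d_min m n \<longrightarrow> num_C m n t d = 0) \<and>
    (m = 2 \<and> (\<exists>k::int. int n = 3 * k + 2) \<longrightarrow>
       2 * \<lfloor>(real n - 1) / 3\<rfloor> + 2 = \<lfloor>(2 * real n + 2) / 3\<rfloor>)"
proof (intro conjI allI impI)
  fix t d
  assume a: "comb_tree m n t \<and> 0 \<le> d \<and> d < d_min m n"
  \<comment> \<open>For \<open>n = 0\<close> the cell numbers are fixed by convention, not by the
    tree; but \<open>d_min m 0 = 0\<close> leaves no \<open>d\<close> to consider.\<close>
  then have "n \<noteq> 0" using d_min_c_min[of m n] by (intro notI) (simp add: c_min_def)
  have "dim F \<noteq> d" if F: "F \<in> critical_cells (Delta m n) {} {} t" for F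
  proof -
    have "card F \<in> cell_sizes t"
      using card_critical_cell[OF comb_tree_matching_tree _ F] a by auto
    then have "c_min m n \<le> card F" using c_min_le_comb(1)[OF assms] a by blast
    then show ?thesis using a by (auto simp: dim_def d_min_c_min)
  qed
  then have "{F \<in> critical_cells (Delta m n) {} {} t. dim F = d} = {}" by blast
  then have "card {F \<in> critical_cells (Delta m n) {} {} t. dim F = d} = 0" by (simp only: card.empty)
  then show "num_C m n t d = 0"
    using \<open>n \<noteq> 0\<close> unfolding num_C_def X_num_cells_def by (cases "d = 0") (simp_all only: if_False if_True, simp_all)
next
  assume "m = 2 \<and> (\<exists>k::int. int n = 3 * k + 2)"
  then obtain k :: int where "int n = 3 * k + 2" by blast
  then have n: "real n = 3 * real_of_int k + 2" by (metis of_int_add of_int_mult of_int_numeral of_int_of_nat_eq)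
  have "\<lfloor>(real n - 1) / 3\<rfloor> = k" "\<lfloor>(2 * real n + 2) / 3\<rfloor> = 2 * k + 2"
    unfolding n by (simp_all add: floor_eq_iff field_simps)
  then show "2 * \<lfloor>(real n - 1) / 3\<rfloor> + 2 = \<lfloor>(2 * real n + 2) / 3\<rfloor>" by simp
qed

end
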